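(* Let $X$ be a set containing two distinct elements $0$ and $1$, and let ${}^{*}X$ be a functional extension of $X$. Then: (i) if $c_{x}:X\to X$ is the constant function with value $x\in X$, then ${}^{*}c_{x}$ is the constant function with value $x$ on ${}^{*}X$; (ii) if $\chi_{A}:X\to X$ is the characteristic function of $A\subseteq X$ (taking values $1$ on $A$ and $0$ off $A$), then ${}^{*}\chi_{A}$ is the characteristic function of a superset ${}^{*}A$ of $A$ in ${}^{*}X$, i.e. ${}^{*}\chi_A$ takes only the values $0,1$ and ${}^{*}A:=\{\xi\in{}^{*}X \mid {}^{*}\chi_A(\xi)=1\}\supseteq A$; (iii) the map $A\mapsto {}^{*}A$ commutes with binary union, binary intersection and complement (i.e. ${}^{*}(A\cup B)={}^{*}A\cup{}^{*}B$, ${}^{*}(A\cap B)={}^{*}A\cap{}^{*}B$, ${}^{*}(X\setminus A)={}^{*}X\setminus{}^{*}A$); moreover ${}^{*}A\cap X=A$ for all $A\subseteq X$, hence $A\mapsto{}^{*}A$ is a Boolean isomorphism of $\mathcal P(X)$ onto a subfield of $\mathcal P({}^{*}X)$.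
   Context: Throughout, $X$ is a set with two distinct distinguished elements $0,1\in X$. A functional extension of $X$ is a superset ${}^{*}X\supseteq X$ together with an assignment to every function $f:X\to X$ of a function ${}^{*}f:{}^{*}X\to{}^{*}X$ extending $f$ (i.e. ${}^{*}f(x)=f(x)$ for $x\in X$) such that for all $f,g:X\to X$ and all $\xi\in{}^{*}X$: (comp) ${}^{*}g({}^{*}f(\xi))={}^{*}(g\circ f)(\xi)$; and (diag) ${}^{*}(\chi\circ(f,g))(\xi)=1$ if ${}^{*}f(\xi)={}^{*}g(\xi)$ and $=0$ otherwise, where $\chi:X\times X\to\{0,1\}\subseteq X$ is the characteristic function of the diagonal ($\chi(x,y)=1\iff x=y$) and $\chi\circ(f,g):X\to X$ is $x\mapsto\chi(f(x),g(x))$. *)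

theory Defs
  imports "HOL-Library.FuncSet" "HOL-Analysis.Sigma_Algebra"
begin

text \<open>Functions between sets are extensional functions \<open>S \<rightarrow>\<^sub>E T\<close>, so that equality of
  HOL functions is equality of the set-theoretic functions. The extension \<open>XX\<close> plays the
  role of \<open>*X\<close>, and \<open>star\<close> is only constrained on functions from \<open>X\<close> to \<open>X\<close>.\<close>

definition char_on :: "'b set \<Rightarrow> 'a \<Rightarrow> 'a \<Rightarrow> 'b set \<Rightarrow> 'b \<Rightarrow> 'a" where
  "char_on D zero one A = (\<lambda>x\<in>D. if x \<in> A then one else zero)"

locale functional_extension =
  fixes X XX :: "'a set" and zero one :: 'a and star :: "('a \<Rightarrow> 'a) \<Rightarrow> 'a \<Rightarrow> 'a"
  assumes zero_in: "zero \<in> X"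
    and one_in: "one \<in> X"
    and zero_neq_one: "zero \<noteq> one"
    and superset: "X \<subseteq> XX"
    and star_funcset: "f \<in> X \<rightarrow>\<^sub>E X \<Longrightarrow> star f \<in> XX \<rightarrow>\<^sub>E XX"
    and star_extends: "\<lbrakk>f \<in> X \<rightarrow>\<^sub>E X; x \<in> X\<rbrakk> \<Longrightarrow> star f x = f x"
    and comp: "\<lbrakk>f \<in> X \<rightarrow>\<^sub>E X; g \<in> X \<rightarrow>\<^sub>E X; \<xi> \<in> XX\<rbrakk>
      \<Longrightarrow> star g (star f \<xi>) = star (compose X g f) \<xi>"
    and diag: "\<lbrakk>f \<in> X \<rightarrow>\<^sub>E X; g \<in> X \<rightarrow>\<^sub>E X; \<xi> \<in> XX\<rbrakk>
      \<Longrightarrow> star (\<lambda>x\<in>X. char_on (X \<times> X) zero one (Id_on X) (f x, g x)) \<xi>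
          = (if star f \<xi> = star g \<xi> then one else zero)"

definition star_set ::
  "'a set \<Rightarrow> 'a set \<Rightarrow> 'a \<Rightarrow> 'a \<Rightarrow> (('a \<Rightarrow> 'a) \<Rightarrow> 'a \<Rightarrow> 'a) \<Rightarrow> 'a set \<Rightarrow> 'a set" where
  "star_set X XX zero one star A = {\<xi> \<in> XX. star (char_on X zero one A) \<xi> = one}"

text \<open>In the library, \<open>algebra \<Omega> M\<close> says that \<open>M\<close> is a field of subsets of \<open>\<Omega>\<close>,
  that is, a subfield of the power set of \<open>\<Omega>\<close>.\<close>

definition boolean_isomorphism ::
  "'a set \<Rightarrow> 'a set set \<Rightarrow> 'b set \<Rightarrow> 'b set set \<Rightarrow> ('a set \<Rightarrow> 'b set) \<Rightarrow> bool" where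
  "boolean_isomorphism \<Omega> M \<Omega>' M' h \<longleftrightarrow>
     algebra \<Omega> M \<and> algebra \<Omega>' M' \<and> bij_betw h M M' \<and>
     h {} = {} \<and> h \<Omega> = \<Omega>' \<and>
     (\<forall>A\<in>M. \<forall>B\<in>M. h (A \<union> B) = h A \<union> h B) \<and>
     (\<forall>A\<in>M. \<forall>B\<in>M. h (A \<inter> B) = h A \<inter> h B) \<and>
     (\<forall>A\<in>M. h (\<Omega> - A) = \<Omega>' - h A)"

end

theory Submission
  imports Defs
begin

text \<open>Axiom (diag) says that equalisers are preserved:
  \<open>*{x. f x = g x} = {\<xi>. *f \<xi> = *g \<xi>}\<close>. Equalisers of characteristic functions and
  constants give complements and symmetric differences only, so a further idea is needed for
  intersections. It is monotonicity: if \<open>a \<in> A \<subseteq> B\<close> and \<open>f\<close> collapses \<open>A\<close> to \<open>a\<close> and is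
  the identity elsewhere, then \<open>A = {x. f x = a}\<close> and \<open>\<chi>\<^sub>B \<circ> f = \<chi>\<^sub>B\<close>, so \<open>\<xi> \<in> *A\<close> gives
  \<open>*f \<xi> = a\<close> and \<open>*\<chi>\<^sub>B \<xi> = *\<chi>\<^sub>B a = 1\<close>. Monotonicity and the preservation of
  symmetric differences yield the intersection, and complements yield the union.\<close>

lemma char_on_funcset:
  "\<lbrakk>zero \<in> Y; one \<in> Y\<rbrakk> \<Longrightarrow> char_on D zero one A \<in> D \<rightarrow>\<^sub>E Y"
  by (auto simp: char_on_def)

context functional_extension
begin

abbreviation chi :: "'a set \<Rightarrow> 'a \<Rightarrow> 'a" where
  "chi A \<equiv> char_on X zero one A"

abbreviation Star :: "'a set \<Rightarrow> 'a set" where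
  "Star A \<equiv> star_set X XX zero one star A"

lemma chi_funcset: "chi A \<in> X \<rightarrow>\<^sub>E X"
  by (intro char_on_funcset zero_in one_in)

lemma chi_eq_one_iff: "x \<in> X \<Longrightarrow> chi A x = one \<longleftrightarrow> x \<in> A"
  using zero_neq_one by (simp add: char_on_def)

lemma const_funcset: "x \<in> X \<Longrightarrow> (\<lambda>_\<in>X. x) \<in> X \<rightarrow>\<^sub>E X"
  by auto

text \<open>On \<open>X\<close>, composing the diagonal's characteristic function with
  \<open>(f, g)\<close> gives the characteristic function of the equaliser of \<open>f\<close> and
  \<open>g\<close>, so this is (diag) in a usable form.\<close>

lemma star_chi_equaliser:
  assumes "f \<in> X \<rightarrow>\<^sub>E X" "g \<in> X \<rightarrow>\<^sub>E X" "\<xi> \<in> XX"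
  shows "star (chi {x \<in> X. f x = g x}) \<xi> = (if star f \<xi> = star g \<xi> then one else zero)"
proof -
  have "chi {x \<in> X. f x = g x} = (\<lambda>x\<in>X. char_on (X \<times> X) zero one (Id_on X) (f x, g x))"
    using assms(1,2) by (fastforce simp: char_on_def fun_eq_iff Id_on_def)
  with diag[OF assms] show ?thesis
    by simp
qed

lemma Star_equaliser:
  assumes "f \<in> X \<rightarrow>\<^sub>E X" "g \<in> X \<rightarrow>\<^sub>E X"
  shows "Star {x \<in> X. f x = g x} = {\<xi> \<in> XX. star f \<xi> = star g \<xi>}"
  using star_chi_equaliser[OF assms] zero_neq_one by (auto simp: star_set_def split: if_splits)

text \<open>The constant \<open>one\<close> is settled by (diag); any other constant factors through
  it, so (comp) reduces the value at \<open>\<xi>\<close> to a value at the point \<open>one\<close>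
  of \<open>X\<close>, where \<open>star\<close> extends the function.\<close>

lemma star_const_apply:
  assumes "x \<in> X" "\<xi> \<in> XX"
  shows "star (\<lambda>_\<in>X. x) \<xi> = x"
proof -
  note const = const_funcset[OF assms(1)] const_funcset[OF one_in]
  \<comment> \<open>A function equalises with itself on all of \<open>X\<close>, so (diag) forces
    the value \<open>one\<close>.\<close>
  have "chi {y \<in> X. (\<lambda>_\<in>X. one) y = (\<lambda>_\<in>X. one) y} = (\<lambda>_\<in>X. one)"
    by (auto simp: char_on_def fun_eq_iff)
  then have one: "star (\<lambda>_\<in>X. one) \<xi> = one"
    using star_chi_equaliser[OF const(2) const(2) assms(2)] by simp
  have "compose X (\<lambda>_\<in>X. x) (\<lambda>_\<in>X. one) = (\<lambda>_\<in>X. x)"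
    using one_in by (auto simp: compose_def fun_eq_iff)
  then have "star (\<lambda>_\<in>X. x) \<xi> = star (\<lambda>_\<in>X. x) one"
    using comp[OF const(2,1) assms(2)] one by simp
  then show ?thesis
    using star_extends[OF const(1) one_in] one_in by simp
qed

lemma star_const: "x \<in> X \<Longrightarrow> star (\<lambda>_\<in>X. x) = (\<lambda>_\<in>XX. x)"
  by (rule extensionalityI[of _ XX])
    (use star_funcset[OF const_funcset] in \<open>auto simp: star_const_apply PiE_def\<close>)

text \<open>\<open>A\<close> is the equaliser of \<open>chi A\<close> and the constant
  \<open>one\<close>, and (diag) allows only two values for the extension of an equaliser's
  characteristic function.\<close>

lemma star_chi_values:
  assumes "\<xi> \<in> XX"
  shows "star (chi A) \<xi> \<in> {zero, one}"
proof -
  have "chi {x \<in> X. chi A x = (\<lambda>_\<in>X. one) x} = chi A"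
    using zero_neq_one by (auto simp: char_on_def fun_eq_iff)
  with star_chi_equaliser[OF chi_funcset const_funcset[OF one_in] assms, of A] show ?thesis
    by (simp split: if_splits)
qed

lemma star_chi: "star (chi A) = char_on XX zero one (Star A)"
proof (rule extensionalityI[of _ XX])
  show "star (chi A) \<in> extensional XX"
    using star_funcset[OF chi_funcset] by (simp add: PiE_def)
  show "char_on XX zero one (Star A) \<in> extensional XX"
    by (simp add: char_on_def)
  show "star (chi A) \<xi> = char_on XX zero one (Star A) \<xi>" if "\<xi> \<in> XX" for \<xi>
    using star_chi_values[OF that, of A] that by (auto simp: char_on_def star_set_def)
qed

lemma Star_subset: "Star A \<subseteq> XX"
  by (auto simp: star_set_def)

lemma Star_Int_base:
  assumes "A \<subseteq> X"
  shows "Star A \<inter> X = A"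
  using assms superset star_extends[OF chi_funcset, of _ A] chi_eq_one_iff[of _ A]
  by (auto simp: star_set_def)

lemma Star_empty: "Star {} = {}"
  using Star_equaliser[OF const_funcset[OF zero_in] const_funcset[OF one_in]] zero_neq_one
  by (simp add: star_const_apply[OF zero_in] star_const_apply[OF one_in] cong: conj_cong)

text \<open>The complement is the equaliser of \<open>chi A\<close> and the constant
  \<open>zero\<close>; since \<open>star (chi A)\<close> is two-valued on \<open>XX\<close>, being
  \<open>zero\<close> there means not being \<open>one\<close>.\<close>

lemma Star_Diff: "Star (X - A) = XX - Star A"
proof -
  have "{x \<in> X. chi A x = (\<lambda>_\<in>X. zero) x} = X - A"
    using zero_neq_one by (auto simp: char_on_def)
  then have "Star (X - A) = {\<xi> \<in> XX. star (chi A) \<xi> = zero}"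
    using Star_equaliser[OF chi_funcset const_funcset[OF zero_in], of A]
    by (simp add: star_const_apply[OF zero_in] cong: conj_cong)
  then show ?thesis
    using star_chi_values[of _ A] zero_neq_one by (auto simp: star_set_def)
qed

text \<open>The set where \<open>A\<close> and \<open>B\<close> agree, the complement of their
  symmetric difference, is the equaliser of \<open>chi A\<close> and \<open>chi B\<close>.\<close>

lemma Star_iff:
  "Star {x \<in> X. x \<in> A \<longleftrightarrow> x \<in> B} = {\<xi> \<in> XX. \<xi> \<in> Star A \<longleftrightarrow> \<xi> \<in> Star B}"
proof -
  have "{x \<in> X. chi A x = chi B x} = {x \<in> X. x \<in> A \<longleftrightarrow> x \<in> B}"
    using zero_neq_one by (auto simp: char_on_def)
  then have "Star {x \<in> X. x \<in> A \<longleftrightarrow> x \<in> B} = {\<xi> \<in> XX. star (chi A) \<xi> = star (chi B) \<xi>}"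
    using Star_equaliser[OF chi_funcset chi_funcset, of A B] by simp
  then show ?thesis
    using star_chi_values[of _ A] star_chi_values[of _ B] by (fastforce simp: star_set_def)
qed

lemma Star_mono:
  assumes "A \<subseteq> B" "B \<subseteq> X"
  shows "Star A \<subseteq> Star B"
\<comment> \<open>Collapsing \<open>A\<close> to one of its points requires \<open>A\<close> to be
  nonempty.\<close>
proof (cases "A = {}")
  case True
  then show ?thesis
    by (simp add: Star_empty)
next
  case False
  then obtain a where a: "a \<in> A" "a \<in> B" "a \<in> X"
    using assms by blast
  define f where "f = (\<lambda>x\<in>X. if x \<in> A then a else x)"
  have f: "f \<in> X \<rightarrow>\<^sub>E X"
    using a by (auto simp: f_def)
  \<comment> \<open>Outside \<open>A\<close> the map fixes points, and \<open>a\<close> lies in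
    \<open>A\<close>, so the value \<open>a\<close> is taken only on \<open>A\<close>.\<close>
  have "{x \<in> X. f x = (\<lambda>_\<in>X. a) x} = A"
    using a assms by (auto simp: f_def)
  then have StarA: "Star A = {\<xi> \<in> XX. star f \<xi> = a}"
    using Star_equaliser[OF f const_funcset[OF a(3)]]
    by (simp add: star_const_apply[OF a(3)] cong: conj_cong)
  have chiB: "compose X (chi B) f = chi B"
    using a assms by (auto simp: f_def compose_def char_on_def fun_eq_iff)
  have "star (chi B) \<xi> = one" if "\<xi> \<in> XX" "star f \<xi> = a" for \<xi>
  proof -
    have "star (chi B) \<xi> = star (chi B) a"
      using comp[OF f chi_funcset that(1), of B] that(2) chiB by simp
    then show ?thesis
      using star_extends[OF chi_funcset a(3), of B] chi_eq_one_iff[OF a(3), of B] a(2) by simp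
  qed
  then show ?thesis
    unfolding StarA by (auto simp: star_set_def)
qed

lemma Star_Int:
  assumes "A \<subseteq> X" "B \<subseteq> X"
  shows "Star (A \<inter> B) = Star A \<inter> Star B"
proof
  show "Star (A \<inter> B) \<subseteq> Star A \<inter> Star B"
    using Star_mono[of "A \<inter> B"] assms by simp
  \<comment> \<open>Both pairs have the same symmetric difference. A point of \<open>Star A\<close>
    and \<open>Star B\<close> lies in \<open>Star (A \<union> B)\<close> by monotonicity, and the
    transferred agreement then puts it in \<open>Star (A \<inter> B)\<close>.\<close>
  have "{x \<in> X. x \<in> A \<longleftrightarrow> x \<in> B} = {x \<in> X. x \<in> A \<inter> B \<longleftrightarrow> x \<in> A \<union> B}"
    by blast
  then have "{\<xi> \<in> XX. \<xi> \<in> Star A \<longleftrightarrow> \<xi> \<in> Star B} =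
      {\<xi> \<in> XX. \<xi> \<in> Star (A \<inter> B) \<longleftrightarrow> \<xi> \<in> Star (A \<union> B)}"
    by (metis Star_iff)
  moreover have "Star A \<subseteq> Star (A \<union> B)"
    using Star_mono[of A "A \<union> B"] assms by simp
  ultimately show "Star A \<inter> Star B \<subseteq> Star (A \<inter> B)"
    using Star_subset[of A] by blast
qed

lemma Star_Un:
  assumes "A \<subseteq> X" "B \<subseteq> X"
  shows "Star (A \<union> B) = Star A \<union> Star B"
proof -
  have "Star (A \<union> B) = Star (X - (X - A) \<inter> (X - B))"
    using assms by (intro arg_cong[where f = Star]) blast
  also have "\<dots> = XX - (XX - Star A) \<inter> (XX - Star B)"
    by (simp add: Star_Diff Star_Int)
  also have "\<dots> = Star A \<union> Star B"
    using Star_subset[of A] Star_subset[of B] by blast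
  finally show ?thesis .
qed

lemma inj_on_Star: "inj_on Star (Pow X)"
  by (rule inj_on_inverseI[where g = "\<lambda>B. B \<inter> X"]) (simp add: Star_Int_base)

text \<open>Closure is inherited from \<open>Pow X\<close>: unions and complements of images are
  images of unions and complements.\<close>

lemma algebra_Star: "algebra XX (Star ` Pow X)"
  unfolding algebra_iff_Un
proof (intro conjI ballI)
  show "Star ` Pow X \<subseteq> Pow XX"
    using Star_subset by blast
  show "{} \<in> Star ` Pow X"
    using Star_empty by (metis Pow_bottom image_eqI)
  show "XX - S \<in> Star ` Pow X" if "S \<in> Star ` Pow X" for S
    using that by (auto simp flip: Star_Diff)
  show "S \<union> T \<in> Star ` Pow X" if "S \<in> Star ` Pow X" "T \<in> Star ` Pow X" for S T
    using that by (auto simp flip: Star_Un)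
qed

lemma boolean_isomorphism_Star:
  "boolean_isomorphism X (Pow X) XX (Star ` Pow X) (star_set X XX zero one star)"
proof -
  have "Star X = XX"
    using Star_Diff[of "{}"] by (simp add: Star_empty)
  moreover have "algebra X (Pow X)"
    by (auto simp: algebra_iff_Un)
  ultimately show ?thesis
    unfolding boolean_isomorphism_def
    by (simp add: algebra_Star inj_on_imp_bij_betw[OF inj_on_Star] Star_empty Star_Un Star_Int
        Star_Diff)
qed

end

theorem theorem1p2:
  fixes X XX :: "'a set" and zero one :: 'a and star :: "('a \<Rightarrow> 'a) \<Rightarrow> 'a \<Rightarrow> 'a"
  assumes "functional_extension X XX zero one star"
  shows
    "(\<forall>x\<in>X. star (\<lambda>_\<in>X. x) = (\<lambda>_\<in>XX. x)) \<and>
     (\<forall>A. A \<subseteq> X \<longrightarrow>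
        (\<forall>\<xi>\<in>XX. star (char_on X zero one A) \<xi> \<in> {zero, one}) \<and>
        star (char_on X zero one A) = char_on XX zero one (star_set X XX zero one star A) \<and>
        A \<subseteq> star_set X XX zero one star A) \<and>
     (\<forall>A B. A \<subseteq> X \<longrightarrow> B \<subseteq> X \<longrightarrow>
        star_set X XX zero one star (A \<union> B)
          = star_set X XX zero one star A \<union> star_set X XX zero one star B \<and>
        star_set X XX zero one star (A \<inter> B)
          = star_set X XX zero one star A \<inter> star_set X XX zero one star B) \<and>
     (\<forall>A. A \<subseteq> X \<longrightarrow>
        star_set X XX zero one star (X - A) = XX - star_set X XX zero one star A) \<and>
     (\<forall>A. A \<subseteq> X \<longrightarrow> star_set X XX zero one star A \<inter> X = A) \<and>
     boolean_isomorphism X (Pow X) XX (star_set X XX zero one star ` Pow X)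
       (star_set X XX zero one star)"
proof -
  interpret functional_extension X XX zero one star
    by (fact assms)
  have "A \<subseteq> Star A" if "A \<subseteq> X" for A
    using Star_Int_base[OF that] by blast
  then show ?thesis
    by (intro conjI allI ballI impI)
      (simp_all only: star_const star_chi_values star_chi[symmetric] Star_Un Star_Int Star_Diff
        Star_Int_base boolean_isomorphism_Star)
qed

end
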